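(* Let $G$ be a group with $\mathcal{V}_\omega(\mathbb{Z}G)=\{1\}$. Then $G$ has no element of order $pq$ with $p<q$ primes, except possibly when $(p,q)=(2,3)$. In particular, if $G$ is either $2$-torsion-free or $3$-torsion-free, then every torsion element of $G$ has prime-power order.
   Context: For an arbitrary (not necessarily finite) group $G$, $\mathbb{Z}G$ is the integral group ring, $\Delta(G)$ is its augmentation ideal, and $\Delta^n(G)$ is the $n$-th power of this ideal. $\mathcal{V}(\mathbb{Z}G)$ is the group of units of augmentation one in $\mathbb{Z}G$; for $n\ge 1$, $\mathcal{V}_n(\mathbb{Z}G)=\mathcal{V}(\mathbb{Z}G)\cap(1+\Delta^n(G))$; and $\mathcal{V}_\omega(\mathbb{Z}G)=\bigcap_{n=1}^\infty\mathcal{V}_n(\mathbb{Z}G)$ (the $\Delta$-adic residue of $\mathcal{V}(\mathbb{Z}G)$). For a prime $p$, a group is $p$-torsion-free if it has no element of order $p$. *)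

theory Defs
  imports "HOL-Algebra.Algebra"
begin

text \<open>
  The integral group ring of a group with explicit carrier. Its elements are the finitely
  supported functions \<open>'a \<Rightarrow>\<^sub>0 int\<close> whose support lies in the carrier, so the additive group is
  \<^const>\<open>free_Abelian_group\<close> on the carrier, and \<open>frag_of x\<close> is the group element \<open>x\<close>.
  The multiplication is the bilinear extension of
  \<open>frag_of x \<otimes> frag_of y = frag_of (x \<otimes> y)\<close>.
\<close>

definition group_ring_mult ::
    "('a, 'm) monoid_scheme \<Rightarrow> ('a \<Rightarrow>\<^sub>0 int) \<Rightarrow> ('a \<Rightarrow>\<^sub>0 int) \<Rightarrow> ('a \<Rightarrow>\<^sub>0 int)"
  where "group_ring_mult G a b =
    frag_extend (\<lambda>x. frag_extend (\<lambda>y. frag_of (x \<otimes>\<^bsub>G\<^esub> y)) b) a"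

definition int_group_ring :: "('a, 'm) monoid_scheme \<Rightarrow> ('a \<Rightarrow>\<^sub>0 int) ring"
  where "int_group_ring G =
    \<lparr>carrier = {a. Poly_Mapping.keys a \<subseteq> carrier G},
     monoid.mult = group_ring_mult G,
     one = frag_of \<one>\<^bsub>G\<^esub>,
     ring.zero = 0,
     ring.add = (+)\<rparr>"

definition augmentation :: "('a \<Rightarrow>\<^sub>0 int) \<Rightarrow> int"
  where "augmentation a = (\<Sum>x\<in>Poly_Mapping.keys a. Poly_Mapping.lookup a x)"

definition aug_ideal :: "('a, 'm) monoid_scheme \<Rightarrow> ('a \<Rightarrow>\<^sub>0 int) set"
  where "aug_ideal G = {a \<in> carrier (int_group_ring G). augmentation a = 0}"

text \<open>
  Powers are taken in the multiplicative structure \<^const>\<open>ideals_set\<close>, whose product is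
  \<^const>\<open>ideal_prod\<close> (finite sums of products) and whose unit is the whole ring.
\<close>

definition aug_ideal_power :: "('a, 'm) monoid_scheme \<Rightarrow> nat \<Rightarrow> ('a \<Rightarrow>\<^sub>0 int) set"
  where "aug_ideal_power G n = aug_ideal G [^]\<^bsub>ideals_set (int_group_ring G)\<^esub> n"

definition norm_units :: "('a, 'm) monoid_scheme \<Rightarrow> ('a \<Rightarrow>\<^sub>0 int) set"
  where "norm_units G = {u \<in> Units (int_group_ring G). augmentation u = 1}"

definition norm_units_level :: "('a, 'm) monoid_scheme \<Rightarrow> nat \<Rightarrow> ('a \<Rightarrow>\<^sub>0 int) set"
  where "norm_units_level G n =
    norm_units G \<inter> (\<one>\<^bsub>int_group_ring G\<^esub> <+\<^bsub>int_group_ring G\<^esub> aug_ideal_power G n)"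

definition norm_units_residue :: "('a, 'm) monoid_scheme \<Rightarrow> ('a \<Rightarrow>\<^sub>0 int) set"
  where "norm_units_residue G = (\<Inter>n\<in>{1..}. norm_units_level G n)"

definition torsion_free_at :: "nat \<Rightarrow> ('a, 'm) monoid_scheme \<Rightarrow> bool"
  where "torsion_free_at p G \<longleftrightarrow> \<not> (\<exists>x\<in>carrier G. group.ord G x = p)"

lemma group_ring_mult_of [simp]:
  "group_ring_mult G (frag_of x) (frag_of y) = frag_of (x \<otimes>\<^bsub>G\<^esub> y)"
  by (simp add: group_ring_mult_def)

lemma group_ring_mult_zero [simp]:
  "group_ring_mult G 0 b = 0" "group_ring_mult G a 0 = 0"
  by (simp_all add: group_ring_mult_def frag_extend_eq_0)

lemma group_ring_mult_diff_left:
  "group_ring_mult G (a - b) c = group_ring_mult G a c - group_ring_mult G b c"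
  by (simp add: group_ring_mult_def frag_extend_diff)

lemma group_ring_mult_add_left:
  "group_ring_mult G (a + b) c = group_ring_mult G a c + group_ring_mult G b c"
  by (simp add: group_ring_mult_def frag_extend_add)

lemma frag_extend_fun_add:
  "frag_extend (\<lambda>x. f x + g x) a = frag_extend f a + frag_extend g a"
  by (simp add: frag_extend_def frag_cmul_distrib2 sum.distrib)

lemma group_ring_mult_add_right:
  "group_ring_mult G a (b + c) = group_ring_mult G a b + group_ring_mult G a c"
  by (simp add: group_ring_mult_def frag_extend_add frag_extend_fun_add)

lemma group_ring_mult_diff_right:
  "group_ring_mult G a (b - c) = group_ring_mult G a b - group_ring_mult G a c"
  using group_ring_mult_add_right[of G a "b - c" c] by (simp add: algebra_simps)

context group begin

lemma group_ring_mult_keys: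
  assumes "Poly_Mapping.keys a \<subseteq> carrier G" "Poly_Mapping.keys b \<subseteq> carrier G"
  shows "Poly_Mapping.keys (group_ring_mult G a b) \<subseteq> carrier G"
proof -
  have "Poly_Mapping.keys (frag_extend (\<lambda>y. frag_of (x \<otimes> y)) b) \<subseteq> carrier G"
    if "x \<in> carrier G" for x
    using keys_frag_extend[of "\<lambda>y. frag_of (x \<otimes> y)" b] assms(2) that by fastforce
  then have "(\<Union>x\<in>Poly_Mapping.keys a.
      Poly_Mapping.keys (frag_extend (\<lambda>y. frag_of (x \<otimes> y)) b)) \<subseteq> carrier G"
    using assms(1) by blast
  then show ?thesis
    unfolding group_ring_mult_def by (rule subset_trans[OF keys_frag_extend])
qed

lemma group_ring_mult_one:
  assumes "Poly_Mapping.keys a \<subseteq> carrier G"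
  shows "group_ring_mult G (frag_of \<one>) a = a" "group_ring_mult G a (frag_of \<one>) = a"
  using assms
  by (induction a rule: frag_induction)
     (simp_all add: group_ring_mult_diff_left group_ring_mult_diff_right)

lemma group_ring_mult_assoc:
  assumes "Poly_Mapping.keys a \<subseteq> carrier G" "Poly_Mapping.keys b \<subseteq> carrier G"
    "Poly_Mapping.keys c \<subseteq> carrier G"
  shows "group_ring_mult G (group_ring_mult G a b) c = group_ring_mult G a (group_ring_mult G b c)"
  using assms(1)
proof (induction a rule: frag_induction)
  case (one x)
  show ?case using assms(2)
  proof (induction b rule: frag_induction)
    case (one y)
    show ?case using assms(3)
      by (induction c rule: frag_induction)
         (use \<open>x \<in> carrier G\<close> one in \<open>simp_all add: m_assoc group_ring_mult_diff_right\<close>)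
  qed (simp_all add: group_ring_mult_diff_left group_ring_mult_diff_right)
qed (simp_all add: group_ring_mult_diff_left)

lemma ring_int_group_ring: "ring (int_group_ring G)"
proof (rule ringI)
  show "abelian_group (int_group_ring G)"
  proof (rule abelian_groupI)
    fix a assume "a \<in> carrier (int_group_ring G)"
    then show "\<exists>b\<in>carrier (int_group_ring G).
        b \<oplus>\<^bsub>int_group_ring G\<^esub> a = \<zero>\<^bsub>int_group_ring G\<^esub>"
      by (intro bexI[of _ "- a"]) (simp_all add: int_group_ring_def)
  qed (auto simp: int_group_ring_def algebra_simps dest!: subsetD[OF keys_add])
  show "monoid (int_group_ring G)"
    by (rule monoidI)
       (auto simp: int_group_ring_def group_ring_mult_one group_ring_mult_assoc
             dest: subsetD[OF group_ring_mult_keys])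
qed (simp_all add: int_group_ring_def group_ring_mult_add_left group_ring_mult_add_right)

end

lemma augmentation_of [simp]: "augmentation (frag_of x) = 1"
  by (simp add: augmentation_def)

lemma augmentation_zero [simp]: "augmentation 0 = 0"
  by (simp add: augmentation_def)

lemma augmentation_superset:
  assumes "finite S" "Poly_Mapping.keys a \<subseteq> S"
  shows "augmentation a = sum (Poly_Mapping.lookup a) S"
  unfolding augmentation_def
  using assms by (intro sum.mono_neutral_left) (auto simp: in_keys_iff)

lemma augmentation_add: "augmentation (a + b) = augmentation a + augmentation b"
proof -
  let ?S = "Poly_Mapping.keys a \<union> Poly_Mapping.keys b"
  have "augmentation a = sum (Poly_Mapping.lookup a) ?S"
    "augmentation b = sum (Poly_Mapping.lookup b) ?S"
    "augmentation (a + b) = sum (Poly_Mapping.lookup (a + b)) ?S"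
    by (rule augmentation_superset; simp add: keys_add)+
  then show ?thesis
    by (simp only: sum.distrib[symmetric]) (rule sum.cong[OF refl lookup_add])
qed

lemma augmentation_diff: "augmentation (a - b) = augmentation a - augmentation b"
  using augmentation_add[of "a - b" b] by simp

lemma augmentation_mult:
  "augmentation (group_ring_mult G a b) = augmentation a * augmentation b"
proof -
  have "Poly_Mapping.keys a \<subseteq> UNIV" by simp
  then show ?thesis
  proof (induction a rule: frag_induction)
    case (one x)
    have "Poly_Mapping.keys b \<subseteq> UNIV" by simp
    then show ?case
      by (induction b rule: frag_induction)
         (simp_all add: group_ring_mult_diff_right augmentation_diff)
  qed (simp_all add: group_ring_mult_diff_left augmentation_diff algebra_simps)
qed

lemma (in group) ideal_aug_ideal: "ideal (aug_ideal G) (int_group_ring G)"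
proof -
  interpret R: ring "int_group_ring G" by (rule ring_int_group_ring)
  have inv: "\<ominus>\<^bsub>int_group_ring G\<^esub> a = - a" if "a \<in> carrier (int_group_ring G)" for a
    using that by (intro R.minus_equality) (simp_all add: int_group_ring_def)
  have uminus: "augmentation (- a) = - augmentation a" for a :: "'a \<Rightarrow>\<^sub>0 int"
    using augmentation_diff[of 0 a] by simp
  show ?thesis
  proof (rule idealI)
    show "subgroup (aug_ideal G) (add_monoid (int_group_ring G))"
    proof (rule R.add.subgroupI)
      show "aug_ideal G \<noteq> {}"
        by (auto simp: aug_ideal_def int_group_ring_def intro: exI[of _ 0])
    next
      fix a assume "a \<in> aug_ideal G"
      then show "\<ominus>\<^bsub>int_group_ring G\<^esub> a \<in> aug_ideal G"
        using inv R.add.inv_closed by (auto simp: aug_ideal_def uminus int_group_ring_def)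
    next
      fix a b assume "a \<in> aug_ideal G" "b \<in> aug_ideal G"
      then show "a \<oplus>\<^bsub>int_group_ring G\<^esub> b \<in> aug_ideal G"
        using keys_add[of a b]
        by (auto simp: aug_ideal_def int_group_ring_def augmentation_add)
    qed (auto simp: aug_ideal_def)
  qed (use R.ring_axioms in \<open>auto simp: aug_ideal_def int_group_ring_def augmentation_mult
         dest: subsetD[OF group_ring_mult_keys]\<close>)
qed

end

theory Submission
  imports Defs "HOL-Computational_Algebra.Polynomial"
begin

text \<open>
  If \<open>x\<close> has order \<open>p q\<close> with \<open>p < q\<close> prime and \<open>(p, q) \<noteq> (2, 3)\<close>, then already the integral
  group ring of the cyclic group generated by \<open>x\<close> contains a nontrivial unit of the residue.
  Put \<open>a = x\<^sup>q\<close> and \<open>b = x\<^sup>p\<close>, of orders \<open>p\<close> and \<open>q\<close>, with norms \<open>N\<^sub>a = 1 + a + \<dots> + a\<^sup>p\<^sup>-\<^sup>1\<close> and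
  \<open>N\<^sub>b = 1 + b + \<dots> + b\<^sup>q\<^sup>-\<^sup>1\<close>. Two things are needed.

  First, an element \<open>r\<close> with \<open>r N\<^sub>a = r N\<^sub>b = 0\<close> lies in every power of the augmentation ideal.
  Choose \<open>\<alpha> p + \<beta> q = 1\<close>. Then \<open>d = 1 - \<alpha> N\<^sub>a - \<beta> N\<^sub>b\<close> has augmentation zero and \<open>r = r d\<close>, so
  \<open>r = r d = r d\<^sup>2 = \<dots>\<close>. Hence any unit \<open>w\<close> for which both norms annihilate \<open>w - 1\<close> belongs to the
  residue (\<open>residue_unit\<close>).

  Second, a unit \<open>w \<noteq> 1\<close> of this kind. If \<open>y\<close> has odd order, then \<open>1 + y\<close> and \<open>1 + y\<^sup>2\<close> divide each
  other, and \<open>u(y) = (1 + y\<^sup>2) / (1 + y)\<close> is a unit, written as an alternating sum of powers of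
  \<open>y\<close>.

  \<^item> For \<open>p\<close> odd take \<open>w = u(ab) / (u(a) u(b))\<close>. Setting \<open>a = 1\<close> or \<open>b = 1\<close> turns \<open>w\<close> into \<open>1\<close>, so
    \<open>w - 1\<close> is divisible by \<open>a - 1\<close> and by \<open>b - 1\<close> and is killed by both norms
    (\<open>odd_order_unit\<close>).

  \<^item> For \<open>p = 2\<close> the element \<open>ab\<close> has even order, and another construction is used. As squaring
    is additive modulo 2, \<open>U = u(b)\<^sup>2 / u(b\<^sup>2)\<close> is a unit of the form \<open>1 - 2 s\<close>; then
    \<open>w = 1 + (a - 1) s\<close> is a unit that becomes \<open>1\<close> at \<open>a = 1\<close> and \<open>U\<close> at \<open>a = -1\<close>
    (\<open>even_order_unit\<close>).

  That \<open>w \<noteq> 1\<close> is seen by clearing denominators and comparing one coefficient. For \<open>(2, 3)\<close> the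
  comparison fails because \<open>b\<^sup>4 = b\<close>.

  The computations take place in the commutative ring \<open>\<int>[X]\<close> modulo \<open>X\<^sup>n - 1\<close> with \<open>n = p q\<close>, and
  evaluation at \<open>x\<close> carries them to the group ring. The statement on torsion elements follows,
  because a number that is not a prime power is divisible by a product of two distinct primes.
\<close>

section \<open>Units from alternating sums\<close>

definition alt_sum :: "nat \<Rightarrow> 'r::comm_ring_1 \<Rightarrow> 'r"
  where "alt_sum k y = (\<Sum>i<k. (- y) ^ i)"

lemma alt_sum_mult: "odd k \<Longrightarrow> (1 + y) * alt_sum k y = 1 + y ^ k"
  using one_diff_power_eq[of "- y" k] by (simp add: alt_sum_def)

lemma diff_dvd_power_diff: "(y - z) dvd (y ^ i - z ^ i)" for y z :: "'r::comm_ring_1"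
  by (simp add: power_diff_sumr2)

lemma alt_sum_cong: "(y - z) dvd (alt_sum k y - alt_sum k z)"
proof -
  have "alt_sum k y - alt_sum k z = (\<Sum>i<k. (- y) ^ i - (- z) ^ i)"
    by (simp add: alt_sum_def sum_subtractf)
  moreover have "(y - z) dvd ((- y) ^ i - (- z) ^ i)" for i
    using diff_dvd_power_diff[of "- y" "- z" i]
    by (metis minus_diff_minus minus_dvd_iff)
  ultimately show ?thesis by (simp add: dvd_sum)
qed

lemma alt_sum_one: "odd k \<Longrightarrow> alt_sum k (1::'r::comm_ring_1) = 1"
proof -
  have "alt_sum (Suc (2 * i)) (1::'r) = 1" for i
    by (induction i) (simp_all add: alt_sum_def)
  then show "odd k \<Longrightarrow> alt_sum k (1::'r) = 1" by (metis oddE Suc_eq_plus1)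
qed

text \<open>
  The Frobenius map modulo 2; signs are irrelevant there. The construction of the units for
  \<open>p = 2\<close> rests on this congruence.
\<close>

lemma two_dvd_alt_sum_square: "2 dvd ((alt_sum k y)\<^sup>2 - alt_sum k (y\<^sup>2))"
proof (induction k)
  case 0
  then show ?case by (simp add: alt_sum_def)
next
  case (Suc k)
  let ?s = "alt_sum k y" and ?t = "(- y) ^ k" and ?t' = "(- (y\<^sup>2)) ^ k"
  have sq: "?t\<^sup>2 = (y\<^sup>2) ^ k" by (simp add: power_mult[symmetric] mult.commute)
  have "even k \<Longrightarrow> ?t\<^sup>2 - ?t' = 0" and "odd k \<Longrightarrow> ?t\<^sup>2 - ?t' = 2 * ?t\<^sup>2"
    unfolding sq by simp_all
  then have "2 dvd (?t\<^sup>2 - ?t')" by (metis dvd_0_right dvd_triv_left)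
  then have "2 dvd ((?s\<^sup>2 - alt_sum k (y\<^sup>2)) + 2 * (?s * ?t) + (?t\<^sup>2 - ?t'))"
    using Suc.IH by (intro dvd_add dvd_triv_left)
  moreover have "(alt_sum (Suc k) y)\<^sup>2 - alt_sum (Suc k) (y\<^sup>2)
      = (?s\<^sup>2 - alt_sum k (y\<^sup>2)) + 2 * (?s * ?t) + (?t\<^sup>2 - ?t')"
    by (simp add: alt_sum_def power2_sum algebra_simps)
  ultimately show ?case by simp
qed

lemma dvd_power_minus_one:
  fixes y :: "'r::comm_ring_1"
  assumes "M dvd (y ^ n - 1)" "n dvd k"
  shows "M dvd (y ^ k - 1)"
proof -
  obtain l where "k = n * l" using assms(2) by auto
  then have "(y ^ n - 1) dvd (y ^ k - 1)"
    using diff_dvd_power_diff[of "y ^ n" 1 l] by (simp add: power_mult)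
  then show ?thesis using assms(1) dvd_trans by blast
qed

text \<open>
  An odd exponent inverse to 2 modulo the odd number \<open>n\<close>: of the two candidates \<open>(n + 1) / 2\<close> and
  \<open>(n + 1) / 2 + n\<close> exactly one is odd, and oddness is what makes \<open>1 + z\<close> divide \<open>1 + z\<^sup>k\<close>.
\<close>

definition half_exp :: "nat \<Rightarrow> nat"
  where "half_exp n = (if odd ((n + 1) div 2) then (n + 1) div 2 else (n + 1) div 2 + n)"

lemma half_exp:
  assumes "odd n"
  shows "odd (half_exp n)" "n dvd (2 * half_exp n - 1)" "half_exp n > 0"
proof -
  obtain m where m: "n = 2 * m + 1" using assms oddE by blast
  have "2 * half_exp n - 1 = n \<or> 2 * half_exp n - 1 = 3 * n"
    by (auto simp: half_exp_def m)
  then show "n dvd (2 * half_exp n - 1)" by auto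
  show "odd (half_exp n)" "half_exp n > 0" using assms by (auto simp: half_exp_def elim: oddE)
qed

text \<open>
  If \<open>y\<^sup>n = 1\<close> with \<open>n\<close> odd, this is \<open>(1 + y\<^sup>2) / (1 + y)\<close>: the exponent 2 is replaced by the odd
  number \<open>n + 2\<close>, for which the quotient is a polynomial.
\<close>

definition alt_unit :: "nat \<Rightarrow> 'r::comm_ring_1 \<Rightarrow> 'r"
  where "alt_unit n = alt_sum (n + 2)"

text \<open>
  The opposite quotient \<open>(1 + y) / (1 + y\<^sup>2)\<close>, where \<open>y\<close> is written as an odd power of \<open>y\<^sup>2\<close>.
\<close>

definition alt_unit_inv :: "nat \<Rightarrow> 'r::comm_ring_1 \<Rightarrow> 'r"
  where "alt_unit_inv n y = alt_sum (half_exp n) (y\<^sup>2)"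

text \<open>
  Divisibility of a difference by \<open>M\<close> expresses equality in the quotient ring by \<open>M\<close>. In the
  application \<open>M = X\<^sup>n - 1\<close>, and the quotient has no 2-torsion.
\<close>

context
  fixes M :: "'r::comm_ring_1" and n :: nat
  assumes cancel_two: "\<And>f. M dvd (2 * f) \<Longrightarrow> M dvd f" and odd_n: "odd n"
begin

lemma alt_unit_mult:
  assumes "M dvd (y ^ n - 1)"
  shows "M dvd ((1 + y) * alt_unit n y - (1 + y\<^sup>2))"
proof -
  have "(1 + y) * alt_unit n y - (1 + y\<^sup>2) = y\<^sup>2 * (y ^ n - 1)"
    using alt_sum_mult[of "n + 2" y] odd_n
    by (simp add: alt_unit_def power2_eq_square algebra_simps)
  then show ?thesis using assms by simp
qed

lemma alt_unit_inv_mult: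
  assumes "M dvd (y ^ n - 1)"
  shows "M dvd ((1 + y\<^sup>2) * alt_unit_inv n y - (1 + y))"
proof -
  let ?k = "half_exp n"
  have k: "2 * ?k = Suc (2 * ?k - 1)" using half_exp(3)[OF odd_n] by simp
  have "(1 + y\<^sup>2) * alt_unit_inv n y - (1 + y) = y ^ (2 * ?k) - y"
    using half_exp(1)[OF odd_n] by (simp add: alt_unit_inv_def alt_sum_mult power_mult)
  also have "\<dots> = y * (y ^ (2 * ?k - 1) - 1)"
    by (subst k) (simp add: algebra_simps)
  finally show ?thesis
    using dvd_power_minus_one[OF assms half_exp(2)[OF odd_n]] by simp
qed

text \<open>
  The product of the two quotients is 1 after multiplication by \<open>1 + y\<close>. This factor can be
  cancelled: since \<open>n\<close> is odd, \<open>1 + y\<close> divides \<open>1 + y\<^sup>n\<close>, which is congruent to 2.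
\<close>

lemma alt_unit_inverse:
  assumes "M dvd (y ^ n - 1)"
  shows "M dvd (alt_unit n y * alt_unit_inv n y - 1)"
proof (rule cancel_two)
  let ?u = "alt_unit n y" and ?v = "alt_unit_inv n y" and ?h = "alt_sum n y"
  have h: "M dvd (2 - ?h * (1 + y))"
  proof -
    have "2 - ?h * (1 + y) = - (y ^ n - 1)"
      using alt_sum_mult[OF odd_n, of y] by (simp add: mult.commute)
    then show ?thesis using assms by (simp only: dvd_minus_iff)
  qed
  have "2 * (?u * ?v - 1)
      = ?h * (((1 + y) * ?u - (1 + y\<^sup>2)) * ?v + ((1 + y\<^sup>2) * ?v - (1 + y)))
        + (2 - ?h * (1 + y)) * (?u * ?v - 1)"
    by (simp add: algebra_simps power2_eq_square)
  then show "M dvd (2 * (?u * ?v - 1))"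
    using h alt_unit_mult[OF assms] alt_unit_inv_mult[OF assms] by (simp del: right_diff_distrib)
qed

lemma alt_unit_minus_one: "(y - 1) dvd (alt_unit n y - 1)"
  using alt_sum_cong[of y 1 "n + 2"] odd_n by (simp add: alt_unit_def alt_sum_one)

lemma alt_unit_inv_minus_one: "(y - 1) dvd (alt_unit_inv n y - 1)"
proof -
  have "(y\<^sup>2 - 1) dvd (alt_unit_inv n y - 1)"
    using alt_sum_cong[of "y\<^sup>2" 1 "half_exp n"] half_exp(1)[OF odd_n]
    by (simp add: alt_unit_inv_def alt_sum_one)
  moreover have "(y - 1) dvd (y\<^sup>2 - 1)" using diff_dvd_power_diff[of y 1 2] by simp
  ultimately show ?thesis using dvd_trans by blast
qed

text \<open>
  The unit is \<open>w = u(ab) / (u(a) u(b))\<close>. The last conclusion is \<open>w\<close> with its denominators cleared;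
  it serves to prove \<open>w \<noteq> 1\<close>.
\<close>

lemma odd_order_unit:
  assumes a: "M dvd (a ^ n - 1)" and b: "M dvd (b ^ n - 1)"
    and Na: "M dvd ((a - 1) * Na)" and Nb: "M dvd ((b - 1) * Nb)"
  obtains w v where "M dvd (w * v - 1)" "M dvd ((w - 1) * Na)" "M dvd ((w - 1) * Nb)"
    "M dvd (w * ((1 + a * b) * (1 + a\<^sup>2) * (1 + b\<^sup>2)) - (1 + (a * b)\<^sup>2) * (1 + a) * (1 + b))"
proof -
  let ?u = "alt_unit n" and ?v = "alt_unit_inv n"
  define c where "c = a * b"
  have "c ^ n - 1 = a ^ n * (b ^ n - 1) + (a ^ n - 1)"
    by (simp add: c_def power_mult_distrib algebra_simps)
  then have c: "M dvd (c ^ n - 1)" using a b by (simp only: dvd_add dvd_mult)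
  define w where "w = ?u c * ?v a * ?v b"
  define v where "v = ?v c * ?u a * ?u b"
  define ia where "ia = ?u a * ?v a - 1"
  define ib where "ib = ?u b * ?v b - 1"
  define ic where "ic = ?u c * ?v c - 1"
  have i: "M dvd ia" "M dvd ib" "M dvd ic"
    using alt_unit_inverse a b c by (simp_all add: ia_def ib_def ic_def)
  have "w * v - 1 = ic * (ia + 1) * (ib + 1) + ia * (ib + 1) + ib"
    unfolding w_def v_def ia_def ib_def ic_def by (simp add: algebra_simps power2_eq_square)
  then have 1: "M dvd (w * v - 1)" using i by simp
  (* At y = 1 the unit w becomes u(z) / (u(1) u(z)) = 1, so w - 1 is a multiple of y - 1 modulo M.
     By symmetry this is used for both (y, z) = (a, b) and (y, z) = (b, a). *)
  have step: "M dvd ((w - 1) * N)"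
    if "M dvd ((y - 1) * N)" "c = y * z" "w = ?u c * ?v y * ?v z"
      "M dvd (?u y * ?v y - 1)" "M dvd (?u z * ?v z - 1)" for y z N
  proof -
    have "(c - z) = (y - 1) * z" using that(2) by (simp add: algebra_simps)
    then have "(y - 1) dvd (?u c - ?u z)"
      using alt_sum_cong[of c z "n + 2"] unfolding alt_unit_def by (metis dvd_mult_left)
    then obtain r where r: "?u c - ?u z = (y - 1) * r" by blast
    obtain s where s: "?v y - 1 = (y - 1) * s" using alt_unit_inv_minus_one by blast
    have "(w - 1) * N = ((y - 1) * N) * (r * ?v y * ?v z + ?u z * ?v z * s)
        + (?u z * ?v z - 1) * N"
    proof -
      have "(w - 1) * N = (?u c - ?u z) * (?v y * ?v z * N) + (?v y - 1) * (?u z * ?v z * N)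
          + (?u z * ?v z - 1) * N"
        unfolding that(3) by (simp add: algebra_simps)
      then show ?thesis unfolding r s by (simp add: algebra_simps)
    qed
    then show ?thesis using that(1,5) by simp
  qed
  have 2: "M dvd ((w - 1) * Na)"
    using step[of a Na b] Na i by (simp add: c_def w_def ia_def ib_def)
  have 3: "M dvd ((w - 1) * Nb)"
    using step[of b Nb a] Nb i by (simp add: c_def w_def ia_def ib_def mult_ac)
  define ka where "ka = (1 + a\<^sup>2) * ?v a - (1 + a)"
  define kb where "kb = (1 + b\<^sup>2) * ?v b - (1 + b)"
  define kc where "kc = (1 + c) * ?u c - (1 + c\<^sup>2)"
  have k: "M dvd ka" "M dvd kb" "M dvd kc"
    using alt_unit_inv_mult a b alt_unit_mult c by (simp_all add: ka_def kb_def kc_def)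
  have "w * ((1 + c) * (1 + a\<^sup>2) * (1 + b\<^sup>2)) - (1 + c\<^sup>2) * (1 + a) * (1 + b)
      = kc * (ka + (1 + a)) * (kb + (1 + b)) + (1 + c\<^sup>2) * (ka * (kb + (1 + b)) + (1 + a) * kb)"
    unfolding w_def ka_def kb_def kc_def by (simp add: algebra_simps power2_eq_square)
  then have "M dvd (w * ((1 + c) * (1 + a\<^sup>2) * (1 + b\<^sup>2)) - (1 + c\<^sup>2) * (1 + a) * (1 + b))"
    using k by simp
  then show ?thesis using that[OF 1 2 3] by (simp add: c_def)
qed

text \<open>
  Here \<open>1 + a\<close> is the norm of \<open>a\<close>. With \<open>U = u(b)\<^sup>2 / u(b\<^sup>2) = 1 - 2 s\<close> and \<open>U\<^sup>-\<^sup>1 = 1 - 2 t\<close>, the unit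
  and its inverse are \<open>1 + (a - 1) s\<close> and \<open>1 + (a - 1) t\<close>: as \<open>(a - 1)\<^sup>2 = - 2 (a - 1)\<close>, the map
  \<open>1 - 2 s \<mapsto> 1 + (a - 1) s\<close> is multiplicative. The last conclusion is \<open>2 (w - 1) = (a - 1) (1 - U)\<close>
  with \<open>U = (1 + b\<^sup>2)\<^sup>3 / ((1 + b)\<^sup>2 (1 + b\<^sup>4))\<close> and the denominator cleared.
\<close>

lemma even_order_unit:
  assumes a: "M dvd (a\<^sup>2 - 1)" and b: "M dvd (b ^ n - 1)" and Nb: "M dvd ((b - 1) * Nb)"
  obtains w v where "M dvd (w * v - 1)" "M dvd ((w - 1) * (1 + a))" "M dvd ((w - 1) * Nb)"
    "M dvd (2 * (w - 1) * ((1 + b)\<^sup>2 * (1 + b ^ 4))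
            + (a - 1) * ((1 + b\<^sup>2) ^ 3 - (1 + b)\<^sup>2 * (1 + b ^ 4)))"
proof -
  let ?u = "alt_unit n" and ?v = "alt_unit_inv n"
  define c where "c = b\<^sup>2"
  have "c ^ n - 1 = b ^ (n * 2) - 1" by (simp add: c_def power_mult[symmetric] mult.commute)
  then have c: "M dvd (c ^ n - 1)" using dvd_power_minus_one[OF b, of "n * 2"] by simp
  obtain r where r: "(?u b)\<^sup>2 - ?u c = 2 * r"
    using two_dvd_alt_sum_square[of "n + 2" b] unfolding alt_unit_def c_def by blast
  obtain r' where r': "(?v b)\<^sup>2 - ?v c = 2 * r'"
    using two_dvd_alt_sum_square[of "half_exp n" "b\<^sup>2"] unfolding alt_unit_inv_def c_def by blast
  define s where "s = - r * ?v c"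
  define t where "t = - r' * ?u c"
  define w where "w = 1 + (a - 1) * s"
  define v where "v = 1 + (a - 1) * t"
  define ib where "ib = ?u b * ?v b - 1"
  define ic where "ic = ?u c * ?v c - 1"
  have i: "M dvd ib" "M dvd ic" using alt_unit_inverse b c by (simp_all add: ib_def ic_def)
  have s2: "1 - 2 * s = (?u b)\<^sup>2 * ?v c - ic" 
  proof -
    have "1 - 2 * s = 1 + ((?u b)\<^sup>2 - ?u c) * ?v c" by (simp add: s_def r)
    then show ?thesis by (simp add: ic_def algebra_simps)
  qed
  have t2: "1 - 2 * t = (?v b)\<^sup>2 * ?u c - ic" 
  proof -
    have "1 - 2 * t = 1 + ((?v b)\<^sup>2 - ?v c) * ?u c" by (simp add: t_def r')
    then show ?thesis by (simp add: ic_def algebra_simps)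
  qed
  have "2 * (s + t - 2 * s * t) = 1 - (1 - 2 * s) * (1 - 2 * t)" by (simp add: algebra_simps power2_eq_square)
  also have "\<dots> = ic * ((?u b)\<^sup>2 * ?v c + (?v b)\<^sup>2 * ?u c - ic)
      - ((ib\<^sup>2 + 2 * ib) * (ic + 1) + ic)"
    unfolding s2 t2 unfolding ib_def ic_def by (simp add: algebra_simps power2_eq_square)
  also have "M dvd \<dots>" using i by (simp add: power2_eq_square)
  finally have st: "M dvd (s + t - 2 * s * t)" by (rule cancel_two)
  have "w * v - 1 = (a - 1) * (s + t - 2 * s * t) + (a\<^sup>2 - 1) * (s * t)"
    unfolding w_def v_def by (simp add: algebra_simps power2_eq_square)
  then have 1: "M dvd (w * v - 1)" using st a by simp
  have "(w - 1) * (1 + a) = (a\<^sup>2 - 1) * s" unfolding w_def by (simp add: algebra_simps power2_eq_square)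
  then have 2: "M dvd ((w - 1) * (1 + a))" using a by simp
  (* Since u(1) = 1, b - 1 divides 1 - U = 2 s; the factor 2 disappears only after multiplying by Nb,
     where it can be cancelled modulo M. *)
  obtain f where f: "?u b - 1 = (b - 1) * f" using alt_unit_minus_one by blast
  obtain g where "?u c - 1 = (c - 1) * g" using alt_unit_minus_one by blast
  then have g: "?u c - 1 = (b - 1) * ((b + 1) * g)"
    by (simp add: c_def power2_eq_square algebra_simps)
  have "2 * ((w - 1) * Nb)
      = ((b - 1) * Nb) * ((a - 1) * ?v c * ((b + 1) * g - f * (?u b + 1)))"
  proof -
    have "2 * ((w - 1) * Nb) = - (2 * r) * ((a - 1) * ?v c * Nb)"
      by (simp add: w_def s_def algebra_simps)
    also have "\<dots> = ((?u c - 1) - (?u b - 1) * (?u b + 1)) * ((a - 1) * ?v c * Nb)"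
      unfolding r[symmetric] by (simp add: algebra_simps power2_eq_square)
    finally show ?thesis unfolding f g by (simp add: algebra_simps power2_eq_square)
  qed
  then have "M dvd (2 * ((w - 1) * Nb))" using Nb by simp
  then have 3: "M dvd ((w - 1) * Nb)" by (rule cancel_two)
  define kb where "kb = (1 + b) * ?u b - (1 + b\<^sup>2)"
  define kc where "kc = (1 + c\<^sup>2) * ?v c - (1 + c)"
  have k: "M dvd kb" "M dvd kc"
    using alt_unit_inv_mult alt_unit_mult b c by (simp_all add: kb_def kc_def)
  have "2 * (w - 1) * ((1 + b)\<^sup>2 * (1 + b ^ 4))
            + (a - 1) * ((1 + b\<^sup>2) ^ 3 - (1 + b)\<^sup>2 * (1 + b ^ 4))
      = (a - 1) * (ic * ((1 + b)\<^sup>2 * (1 + b ^ 4)) + (1 + b\<^sup>2) ^ 3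
          - (kb + (1 + b\<^sup>2))\<^sup>2 * (kc + (1 + c)))"
  proof -
    let ?P = "(1 + b)\<^sup>2 * (1 + b ^ 4)"
    have "2 * (w - 1) = (a - 1) * (1 - (1 - 2 * s))" by (simp add: w_def algebra_simps)
    moreover have "(kb + (1 + b\<^sup>2))\<^sup>2 * (kc + (1 + c)) = (?u b)\<^sup>2 * ?v c * ?P"
      by (simp add: kb_def kc_def c_def power_mult_distrib mult_ac)
    moreover have "(a - 1) * (1 - (E - ic)) * P + (a - 1) * (Q - P) = (a - 1) * (ic * P + Q - E * P)"
      for E P Q by (simp add: algebra_simps)
    ultimately show ?thesis by (simp only: s2)
  qed
  also have "\<dots> = (a - 1) * (ic * ((1 + b)\<^sup>2 * (1 + b ^ 4))
      - kb * (kb + 2 * (1 + b\<^sup>2)) * (kc + (1 + c)) - (1 + b\<^sup>2)\<^sup>2 * kc)"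
    unfolding c_def by (simp add: algebra_simps power2_eq_square power3_eq_cube)
  also have "M dvd \<dots>" using i k by simp
  finally show ?thesis using that[OF 1 2 3] by simp
qed

end

section \<open>Polynomials evaluated at a group element\<close>

lemma group_ring_mult_cmul_left:
  "group_ring_mult G (frag_cmul c a) b = frag_cmul c (group_ring_mult G a b)"
  by (simp add: group_ring_mult_def frag_extend_cmul)

lemma augmentation_cmul: "augmentation (frag_cmul c a) = c * augmentation a"
  using augmentation_superset[of "Poly_Mapping.keys a" "frag_cmul c a"]
  by (simp add: keys_cmul augmentation_def sum_distrib_left)

text \<open>
  The constant polynomial 2 is prime in \<open>\<int>[X]\<close> and does not divide a monic polynomial.
\<close>

lemma two_cancel_monic:
  fixes f M :: "int poly"
  assumes "lead_coeff M = 1" "M dvd (2 * f)"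
  shows "M dvd f"
proof -
  obtain g where g: "2 * f = M * g" using assms(2) by blast
  have two: "(2 :: int poly) = [:2:]" by (simp add: numeral_poly)
  have "prime_elem ([:2:] :: int poly)" by (simp add: prime_elem_const_poly_iff)
  moreover have "[:2:] dvd M * g" using g two by (metis dvd_triv_left)
  moreover have "\<not> [:2:] dvd M"
    using assms(1) const_poly_dvd_iff[of 2 M] by (metis odd_one)
  ultimately have "[:2:] dvd g" using prime_elem_dvd_mult_iff by blast
  then obtain h where "g = 2 * h" unfolding two[symmetric] by (rule dvdE)
  then have "2 * f = 2 * (M * h)" using g by (simp add: mult_ac)
  then show ?thesis by simp
qed

context group
begin

text \<open>
  The ring homomorphism from \<open>\<int>[X]\<close> to the group ring that sends \<open>X\<close> to \<open>x\<close>, by Horner's scheme.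
\<close>

definition poly_at :: "'a \<Rightarrow> int poly \<Rightarrow> 'a \<Rightarrow>\<^sub>0 int"
  where "poly_at x f =
    fold_coeffs (\<lambda>c r. frag_cmul c (frag_of \<one>) + group_ring_mult G (frag_of x) r) f 0"

lemma poly_at_0 [simp]: "poly_at x 0 = 0"
  by (simp add: poly_at_def)

lemma poly_at_pCons:
  "poly_at x (pCons c f) = frag_cmul c (frag_of \<one>) + group_ring_mult G (frag_of x) (poly_at x f)"
  by (cases "c = 0 \<and> f = 0") (auto simp: poly_at_def)

lemma poly_at_add: "poly_at x (f + g) = poly_at x f + poly_at x g"
  by (induction f g rule: poly_induct2)
     (simp_all add: poly_at_pCons frag_cmul_distrib group_ring_mult_add_right)

lemma poly_at_diff: "poly_at x (f - g) = poly_at x f - poly_at x g"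
  using poly_at_add[of x "f - g" g] by simp

lemma augmentation_poly_at: "augmentation (poly_at x f) = poly f 1"
  by (induction f)
     (simp_all add: poly_at_pCons augmentation_add augmentation_cmul augmentation_mult)

context
  fixes x assumes x: "x \<in> carrier G"
begin

lemma keys_poly_at: "Poly_Mapping.keys (poly_at x f) \<subseteq> carrier G"
proof (induction f)
  case (pCons c f)
  have "Poly_Mapping.keys (group_ring_mult G (frag_of x) (poly_at x f)) \<subseteq> carrier G"
    using pCons x by (intro group_ring_mult_keys) simp_all
  moreover have "Poly_Mapping.keys (frag_cmul c (frag_of \<one>)) \<subseteq> carrier G"
    by (rule order_trans[OF keys_cmul]) simp
  ultimately show ?case
    unfolding poly_at_pCons by (intro order_trans[OF keys_add] Un_least)
qed simp

lemma poly_at_smult: "poly_at x (smult c f) = frag_cmul c (poly_at x f)"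
proof (induction f)
  case (pCons d f)
  have "group_ring_mult G (frag_of x) (frag_cmul c b)
      = frag_cmul c (group_ring_mult G (frag_of x) b)" for b
    by (simp add: group_ring_mult_def frag_extend_cmul)
  then show ?case
    using pCons by (simp add: poly_at_pCons frag_cmul_distrib2)
qed simp

lemma poly_at_mult: "poly_at x (f * g) = group_ring_mult G (poly_at x f) (poly_at x g)"
proof (induction f)
  case (pCons c f)
  then show ?case
    using x keys_poly_at
    by (simp add: poly_at_pCons poly_at_add poly_at_smult group_ring_mult_add_left
        group_ring_mult_cmul_left group_ring_mult_one group_ring_mult_assoc)
qed simp

lemma poly_at_power: "poly_at x ([:0, 1:] ^ k) = frag_of (x [^] k)"
proof (induction k)
  case 0
  then show ?case by (simp add: one_pCons poly_at_pCons)
next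
  case (Suc k)
  have "poly_at x [:0, 1:] = frag_of x" using x by (simp add: poly_at_pCons)
  then show ?case
    by (simp only: power_Suc2 poly_at_mult Suc group_ring_mult_of nat_pow_Suc)
qed

lemma poly_at_one: "poly_at x 1 = frag_of \<one>"
  using poly_at_power[of 0] by simp

lemma poly_at_cong:
  assumes "x [^] n = \<one>" "([:0, 1:] ^ n - 1) dvd (f - g)"
  shows "poly_at x f = poly_at x g"
proof -
  obtain h where h: "f - g = ([:0, 1:] ^ n - 1) * h" using assms(2) by blast
  have "poly_at x (f - g) = 0"
    unfolding h by (simp add: poly_at_mult poly_at_diff poly_at_power poly_at_one assms(1))
  then show ?thesis by (simp add: poly_at_diff)
qed

text \<open>
  A factor \<open>d\<close> from the augmentation ideal with \<open>r = r d\<close> can be split off any number of times.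
\<close>

lemma absorbing_factor_in_aug_ideal_power:
  assumes "poly_at x r = poly_at x (r * d)" "poly d 1 = 0"
  shows "poly_at x r \<in> aug_ideal_power G m"
proof (induction m)
  case 0
  have "aug_ideal_power G 0 = carrier (int_group_ring G)"
    by (simp add: aug_ideal_power_def ideals_set_def)
  then show ?case using keys_poly_at by (simp add: int_group_ring_def)
next
  case (Suc m)
  have "poly_at x d \<in> aug_ideal G"
    using assms(2) keys_poly_at by (simp add: aug_ideal_def int_group_ring_def augmentation_poly_at)
  with Suc have "poly_at x r \<otimes>\<^bsub>int_group_ring G\<^esub> poly_at x d
      \<in> ideal_prod (int_group_ring G) (aug_ideal_power G m) (aug_ideal G)"
    by (rule ideal_prod.prod)
  moreover have "poly_at x r \<otimes>\<^bsub>int_group_ring G\<^esub> poly_at x d = poly_at x r"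
    using assms(1) by (simp add: int_group_ring_def poly_at_mult)
  moreover have "aug_ideal_power G (Suc m)
      = ideal_prod (int_group_ring G) (aug_ideal_power G m) (aug_ideal G)"
    by (simp add: aug_ideal_power_def ideals_set_def nat_pow_def)
  ultimately show ?case by simp
qed

text \<open>
  The coprime numbers \<open>poly Na 1\<close> and \<open>poly Nb 1\<close> are the augmentations of the two annihilators.
  A Bezout combination of \<open>Na\<close> and \<open>Nb\<close> has augmentation 1 and kills \<open>w - 1\<close>, so its difference
  from 1 absorbs \<open>w - 1\<close>.
\<close>

lemma residue_unit:
  fixes w v Na Nb :: "int poly" and n :: nat
  defines "M \<equiv> [:0, 1:] ^ n - 1"
  assumes n: "x [^] n = \<one>"
    and unit: "M dvd (w * v - 1)"
    and Na: "M dvd ((w - 1) * Na)" and Nb: "M dvd ((w - 1) * Nb)"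
    and coprime: "coprime (poly Na 1) (poly Nb 1)"
  shows "poly_at x w \<in> norm_units_residue G"
proof -
  obtain \<alpha> \<beta> where bezout: "\<alpha> * poly Na 1 + \<beta> * poly Nb 1 = 1"
    using coprime bezout_int[of "poly Na 1" "poly Nb 1"] by auto
  define d where "d = 1 - ([:\<alpha>:] * Na + [:\<beta>:] * Nb)"
  have d1: "poly d 1 = 0" using bezout by (simp add: d_def)
  have "(w - 1) - (w - 1) * d = [:\<alpha>:] * ((w - 1) * Na) + [:\<beta>:] * ((w - 1) * Nb)"
    unfolding d_def by (simp add: algebra_simps del: mult_pCons_left mult_pCons_right)
  then have dvd: "M dvd ((w - 1) - (w - 1) * d)"
    using Na Nb by (simp only: dvd_add dvd_mult)
  then have "poly_at x (w - 1) = poly_at x ((w - 1) * d)"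
    using poly_at_cong[OF n] unfolding M_def by blast
  then have power: "poly_at x (w - 1) \<in> aug_ideal_power G m" for m
    using d1 by (rule absorbing_factor_in_aug_ideal_power)
  have "poly ((w - 1) - (w - 1) * d) 1 = 0"
  proof -
    obtain h where "(w - 1) - (w - 1) * d = M * h" using dvd by blast
    then show ?thesis by (simp add: M_def del: right_diff_distrib)
  qed
  then have w1: "poly w 1 = 1" using d1 by simp
  have "poly_at x (w * v) = frag_of \<one>"
    using poly_at_cong[OF n] unit poly_at_one unfolding M_def by metis
  then have "poly_at x w \<in> Units (int_group_ring G)"
    using keys_poly_at[of w] keys_poly_at[of v] poly_at_mult[of w v] poly_at_mult[of v w]
    unfolding Units_def int_group_ring_def mult.commute[of v w]
    by (intro CollectI conjI bexI[of _ "poly_at x v"]) simp_all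
  then have "poly_at x w \<in> norm_units G"
    using w1 by (simp add: norm_units_def augmentation_poly_at)
  moreover have "poly_at x w = frag_of \<one> + poly_at x (w - 1)"
    by (simp add: poly_at_diff poly_at_one)
  ultimately show ?thesis
    using power
    by (auto simp: norm_units_residue_def norm_units_level_def a_l_coset_def' int_group_ring_def)
qed

lemma pow_eq_imp_dvd:
  fixes i j :: nat
  assumes "x [^] i = x [^] j"
  shows "int (ord x) dvd int i - int j"
  using assms x int_pow_eq[of x "int j" "int i"] by (simp add: int_pow_int)

end

end

section \<open>Elements of order $pq$\<close>

lemma lookup_frag_of: "Poly_Mapping.lookup (frag_of y) z = (if y = z then 1 else (0::int))"
  by (simp add: lookup_single when_def)

lemma lead_coeff_X_power_minus_one:
  assumes "n > 0"
  shows "lead_coeff ([:0, 1:] ^ n - 1 :: int poly) = 1"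
proof -
  have "lead_coeff (- 1 + [:0, 1:] ^ n :: int poly) = lead_coeff ([:0, 1:] ^ n :: int poly)"
    using assms by (intro lead_coeff_add_le) (simp add: degree_power_eq)
  also have "\<dots> = 1" by (simp only: lead_coeff_power) simp
  finally show ?thesis by simp
qed

text \<open>
  If \<open>w\<close> were 1, then \<open>(1 + a\<^sup>2 b\<^sup>2) (1 + a) (1 + b) = (1 + ab) (1 + a\<^sup>2) (1 + b\<^sup>2)\<close>, that is,
  \<open>a + b + a\<^sup>3 b\<^sup>2 + a\<^sup>2 b\<^sup>3 = a\<^sup>2 + b\<^sup>2 + a\<^sup>3 b + a b\<^sup>3\<close>. The group element \<open>a\<close> does not occur on the
  right, because \<open>b\<^sup>3 \<noteq> 1\<close> for \<open>q > 3\<close>.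
\<close>

lemma (in group) no_element_of_odd_order_pq:
  assumes res: "norm_units_residue G = {\<one>\<^bsub>int_group_ring G\<^esub>}"
    and x: "x \<in> carrier G" and ord: "ord x = p * q"
    and p: "Factorial_Ring.prime p" and q: "Factorial_Ring.prime q" and "2 < p" "p < q"
  shows False
proof -
  define T where "T = [:0, 1 :: int:]"
  define n where "n = p * q"
  define M where "M = T ^ n - 1"
  define a where "a = T ^ q"
  define b where "b = T ^ p"
  have n: "odd n" "n > 0"
    using p q \<open>2 < p\<close> \<open>p < q\<close> by (auto simp: n_def prime_odd_nat)
  have xn: "x [^] n = \<one>" using x pow_ord_eq_1[OF x] ord by (simp add: n_def)
  have cancel: "M dvd f" if "M dvd 2 * f" for f
    using that unfolding M_def T_def
    by (rule two_cancel_monic[OF lead_coeff_X_power_minus_one[OF n(2)]])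
  have aM: "a ^ p - 1 = M" and bM: "b ^ q - 1 = M"
    unfolding a_def b_def M_def n_def power_mult[symmetric] by (simp_all only: mult.commute)
  have Na: "M dvd (a - 1) * (\<Sum>i<p. a ^ i)" and Nb: "M dvd (b - 1) * (\<Sum>i<q. b ^ i)"
    unfolding power_diff_1_eq[symmetric] aM bM by simp_all
  have an: "M dvd a ^ n - 1" and bn: "M dvd b ^ n - 1"
    using dvd_power_minus_one[of M a p n] dvd_power_minus_one[of M b q n]
    unfolding aM bM n_def by simp_all
  obtain w v where w: "M dvd (w * v - 1)" "M dvd ((w - 1) * (\<Sum>i<p. a ^ i))"
      "M dvd ((w - 1) * (\<Sum>i<q. b ^ i))"
      "M dvd (w * ((1 + a * b) * (1 + a\<^sup>2) * (1 + b\<^sup>2)) - (1 + (a * b)\<^sup>2) * (1 + a) * (1 + b))"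
    by (rule odd_order_unit[OF cancel n(1) an bn Na Nb])
  have "p \<noteq> q" using \<open>p < q\<close> by simp
  then have "coprime (int p) (int q)" using p q by (simp add: primes_coprime)
  then have "coprime (poly (\<Sum>i<p. a ^ i) 1) (poly (\<Sum>i<q. b ^ i) 1)"
    by (simp add: poly_sum poly_power a_def b_def T_def)
  then have "poly_at x w \<in> norm_units_residue G"
    using w(1-3) unfolding M_def T_def by (intro residue_unit[OF x xn])
  then have pw: "poly_at x w = frag_of \<one>" using res by (simp add: int_group_ring_def)
  define f where "f = (1 + a * b) * (1 + a\<^sup>2) * (1 + b\<^sup>2)"
  define g where "g = (1 + (a * b)\<^sup>2) * (1 + a) * (1 + b)"
  define l where "l = T ^ q + T ^ p + T ^ (q * 3 + p * 2) + T ^ (q * 2 + p * 3)"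
  define r where "r = T ^ (q * 2) + T ^ (p * 2) + T ^ (q * 3 + p) + T ^ (q + p * 3)"
  have lr: "l - r = g - f"
    unfolding l_def r_def f_def g_def power_add power_mult a_def[symmetric] b_def[symmetric]
    by (simp add: algebra_simps eval_nat_numeral)
  have "poly_at x g = poly_at x (w * f)"
    using poly_at_cong[OF x xn, of "w * f" g] w(4) unfolding f_def g_def M_def T_def by simp
  also have "\<dots> = poly_at x f"
    using keys_poly_at[OF x] by (simp add: poly_at_mult[OF x] pw group_ring_mult_one)
  finally have "poly_at x l = poly_at x r"
    using arg_cong[OF lr, of "poly_at x"] by (simp add: poly_at_diff)
  then have eq: "Poly_Mapping.lookup (poly_at x l) (x [^] q) = Poly_Mapping.lookup (poly_at x r) (x [^] q)"
    by simp
  have ne: "x [^] j \<noteq> x [^] q" if "\<not> int (p * q) dvd int j - int q" for j :: nat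
    using pow_eq_imp_dvd[OF x, of j q] that ord by auto
  have pq: "\<not> int p dvd int q" "\<not> int q dvd int p"
    using p q \<open>p \<noteq> q\<close> primes_dvd_imp_eq by auto
  have dvd: "int p dvd z" "int q dvd z" if "int (p * q) dvd z" for z
    using that by (auto intro: dvd_trans[rotated])
  have 1: "x [^] (q * 2) \<noteq> x [^] q"
    using dvd(1)[of "int q"] pq prime_gt_0_nat[OF q] by (intro ne) auto
  have "\<not> int p dvd int (p * 2) - int q"
    using pq(1) dvd_diff_right_iff[of "int p" "int (p * 2)" "int q"] by simp
  then have 2: "x [^] (p * 2) \<noteq> x [^] q"
    using dvd(1) by (intro ne) blast
  have "\<not> int q dvd int q * 2 + int p"
    using pq(2) dvd_add_right_iff[of "int q" "int q * 2" "int p"] by simp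
  moreover have "int (q * 3 + p) - int q = int q * 2 + int p" by simp
  ultimately have 3: "x [^] (q * 3 + p) \<noteq> x [^] q"
    using dvd(2) by (intro ne) metis
  have "\<not> int (p * q) dvd int (p * 3)"
    using \<open>2 < p\<close> \<open>p < q\<close> dvd_imp_le[of q 3] by (auto simp flip: of_nat_mult)
  then have 4: "x [^] (q + p * 3) \<noteq> x [^] q" by (intro ne) simp
  have "Poly_Mapping.lookup (poly_at x r) (x [^] q) = 0"
    using 1 2 3 4 unfolding r_def T_def
    by (simp add: poly_at_add poly_at_power[OF x] lookup_add lookup_frag_of)
  moreover have "Poly_Mapping.lookup (poly_at x l) (x [^] q) \<ge> 1"
    unfolding l_def T_def
    by (simp add: poly_at_add poly_at_power[OF x] lookup_add lookup_frag_of)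
  ultimately show False using eq by simp
qed

text \<open>
  If \<open>w\<close> were 1, then \<open>(a - 1) ((1 + b\<^sup>2)\<^sup>3 - (1 + b)\<^sup>2 (1 + b\<^sup>4)) = 0\<close>, that is,
  \<open>a b\<^sup>2 + a b\<^sup>4 + b + b\<^sup>5 = a b + a b\<^sup>5 + b\<^sup>2 + b\<^sup>4\<close> after division by 2. The group element \<open>b\<close> does
  not occur on the right, because \<open>b\<^sup>3 \<noteq> 1\<close> for \<open>q > 3\<close>.
\<close>

lemma (in group) no_element_of_even_order_2q:
  assumes res: "norm_units_residue G = {\<one>\<^bsub>int_group_ring G\<^esub>}"
    and x: "x \<in> carrier G" and ord: "ord x = 2 * q"
    and q: "odd q" "3 < q"
  shows False
proof -
  define T where "T = [:0, 1 :: int:]"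
  define n where "n = 2 * q"
  define M where "M = T ^ n - 1"
  define a where "a = T ^ q"
  define b where "b = T ^ 2"
  have n: "n > 0" using q by (simp add: n_def)
  have xn: "x [^] n = \<one>" using x pow_ord_eq_1[OF x] ord by (simp add: n_def)
  have cancel: "M dvd f" if "M dvd 2 * f" for f
    using that unfolding M_def T_def
    by (rule two_cancel_monic[OF lead_coeff_X_power_minus_one[OF n]])
  have aM: "a\<^sup>2 - 1 = M" and bM: "b ^ q - 1 = M"
    unfolding a_def b_def M_def n_def power_mult[symmetric] by (simp_all only: mult.commute)
  have a2: "M dvd a\<^sup>2 - 1" and bq: "M dvd b ^ q - 1"
    and Nb: "M dvd (b - 1) * (\<Sum>i<q. b ^ i)"
    unfolding power_diff_1_eq[symmetric] aM bM by simp_all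
  obtain w v where w: "M dvd (w * v - 1)" "M dvd ((w - 1) * (1 + a))"
      "M dvd ((w - 1) * (\<Sum>i<q. b ^ i))"
      "M dvd (2 * (w - 1) * ((1 + b)\<^sup>2 * (1 + b ^ 4))
            + (a - 1) * ((1 + b\<^sup>2) ^ 3 - (1 + b)\<^sup>2 * (1 + b ^ 4)))"
    by (rule even_order_unit[OF cancel q(1) a2 bq Nb])
  have "coprime (2 :: int) (int q)" using q by simp
  then have "coprime (poly (1 + a) 1) (poly (\<Sum>i<q. b ^ i) 1)"
    by (simp add: poly_sum poly_power a_def b_def T_def)
  then have "poly_at x w \<in> norm_units_residue G"
    using w(1-3) unfolding M_def T_def by (intro residue_unit[OF x xn])
  then have pw: "poly_at x w = frag_of \<one>" using res by (simp add: int_group_ring_def)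
  define P where "P = (1 + b)\<^sup>2 * (1 + b ^ 4)"
  define l where "l = T ^ (q + 2 * 2) + T ^ (q + 2 * 4) + T ^ 2 + T ^ (2 * 5)"
  define r where "r = T ^ (q + 2) + T ^ (q + 2 * 5) + T ^ (2 * 2) + T ^ (2 * 4)"
  have lr: "(l + l) - (r + r) = (a - 1) * ((1 + b\<^sup>2) ^ 3 - P)"
    unfolding l_def r_def P_def power_add power_mult a_def[symmetric] b_def[symmetric]
    by (simp add: algebra_simps eval_nat_numeral)
  have "poly_at x (2 * (w - 1) * P) = poly_at x ((w - 1) * (2 * P))"
    by (simp only: mult_ac)
  also have "\<dots> = 0"
    by (simp add: poly_at_mult[OF x] poly_at_diff pw poly_at_one[OF x])
  finally have "poly_at x ((a - 1) * ((1 + b\<^sup>2) ^ 3 - P)) = 0"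
    using poly_at_cong[OF x xn, of "2 * (w - 1) * P + (a - 1) * ((1 + b\<^sup>2) ^ 3 - P)" 0] w(4)
    unfolding P_def M_def T_def by (simp add: poly_at_add)
  then have "poly_at x (l + l) = poly_at x (r + r)"
    using arg_cong[OF lr, of "poly_at x"] by (simp add: poly_at_diff)
  then have eq: "Poly_Mapping.lookup (poly_at x l) (x [^] (2::nat))
      = Poly_Mapping.lookup (poly_at x r) (x [^] (2::nat))"
    by (metis poly_at_add lookup_add mult_2 mult_cancel_left zero_neq_numeral)
  have ne: "x [^] j \<noteq> x [^] (2::nat)" if "\<not> int (2 * q) dvd int j - 2" for j :: nat
    using pow_eq_imp_dvd[OF x, of j 2] that ord by auto
  have even: "even z" if "int (2 * q) dvd z" for z using that by (auto intro: dvd_trans[rotated])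
  have small: "\<not> int (2 * q) dvd z" if "0 < z" "z \<le> 6" for z
    using zdvd_imp_le[of "int (2 * q)" z] that q by auto
  have 1: "x [^] (q + 2) \<noteq> x [^] (2::nat)"
    using even[of "int q"] q by (intro ne) auto
  have 2: "x [^] (q + 2 * 5) \<noteq> x [^] (2::nat)"
    using even[of "int (q + 2 * 5) - 2"] q by (intro ne) auto
  have 3: "x [^] (2 * 2 :: nat) \<noteq> x [^] (2::nat)"
    using small[of 2] by (intro ne) simp
  have 4: "x [^] (2 * 4 :: nat) \<noteq> x [^] (2::nat)"
    using small[of 6] by (intro ne) simp
  have "Poly_Mapping.lookup (poly_at x r) (x [^] (2::nat)) = 0"
    using 1 2 3 4 unfolding r_def T_def
    by (simp only: poly_at_add poly_at_power[OF x] lookup_add lookup_frag_of if_False)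
  moreover have "Poly_Mapping.lookup (poly_at x l) (x [^] (2::nat)) \<ge> 1"
    unfolding l_def T_def
    by (simp only: poly_at_add poly_at_power[OF x] lookup_add lookup_frag_of) simp
  ultimately show False using eq by simp
qed

lemma two_primes_dvd_if_not_prime_power:
  fixes N :: nat
  assumes "N > 0" "\<not> (\<exists>r k. Factorial_Ring.prime r \<and> N = r ^ k)"
  obtains p q where "Factorial_Ring.prime p" "Factorial_Ring.prime q" "p < q" "p * q dvd N"
proof -
  have "N \<noteq> 1" using assms(2) two_is_prime_nat power_0 by metis
  then obtain r where r: "Factorial_Ring.prime r" "r dvd N" using prime_factor_nat by blast
  obtain m where m: "N = r ^ multiplicity r N * m" "\<not> r dvd m"
  proof (rule multiplicity_decompose'[of N r])
    show "N \<noteq> 0" "\<not> is_unit r" using assms(1) r(1) by auto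
  qed
  have "m \<noteq> 1" using assms(2) r(1) m(1) by (metis mult.right_neutral)
  then obtain s where s: "Factorial_Ring.prime s" "s dvd m" using prime_factor_nat by blast
  have "r \<noteq> s" using m(2) s(2) by auto
  have "s dvd N" using s(2) by (subst m(1)) (rule dvd_mult)
  with \<open>r \<noteq> s\<close> have "r * s dvd N"
    using r s(1) by (intro divides_mult primes_coprime)
  then have "s * r dvd N" by (simp only: mult.commute)
  from \<open>r \<noteq> s\<close> show thesis
  proof (rule linorder_neqE_nat)
    assume "r < s"
    then show thesis using that[OF r(1) s(1)] \<open>r * s dvd N\<close> by blast
  next
    assume "s < r"
    then show thesis using that[OF s(1) r(1)] \<open>s * r dvd N\<close> by blast
  qed
qed

theorem theorem6:
  fixes G :: "('a, 'm) monoid_scheme" (structure)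
  assumes "group G"
    and "norm_units_residue G = {\<one>\<^bsub>int_group_ring G\<^esub>}"
  shows "(\<forall>p q :: nat. Factorial_Ring.prime p \<and> Factorial_Ring.prime q \<and> p < q \<and> (p, q) \<noteq> (2, 3) \<longrightarrow>
            \<not> (\<exists>x\<in>carrier G. group.ord G x = p * q))
       \<and> (torsion_free_at 2 G \<or> torsion_free_at 3 G \<longrightarrow>
            (\<forall>x\<in>carrier G. (\<exists>n::nat. n > 0 \<and> x [^] n = \<one>) \<longrightarrow>
               (\<exists>r k :: nat. Factorial_Ring.prime r \<and> group.ord G x = r ^ k)))"
proof -
  interpret group G by fact
  have no_pq: False
    if p: "Factorial_Ring.prime p" and q: "Factorial_Ring.prime q" and "p < q" "(p, q) \<noteq> (2, 3)"
      and x: "x \<in> carrier G" "ord x = p * q" for p q x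
  proof (cases "p = 2")
    case True
    have "odd q" using q that(3) True by (simp add: prime_odd_nat)
    moreover have "q \<noteq> 3" using that(4) True by simp
    ultimately have "odd q" "3 < q" using that(3) True by presburger+
    then show False using no_element_of_even_order_2q[OF assms(2) x(1)] x(2) True by simp
  next
    case False
    then have "2 < p" using prime_ge_2_nat[OF p] by simp
    then show False using no_element_of_odd_order_pq[OF assms(2) x p q] \<open>p < q\<close> by simp
  qed
  have "\<exists>r k :: nat. Factorial_Ring.prime r \<and> ord x = r ^ k"
    if tf: "torsion_free_at 2 G \<or> torsion_free_at 3 G" and x: "x \<in> carrier G"
      and tors: "n > 0" "x [^] n = \<one>" for x and n :: nat
  proof (rule ccontr)
    assume contr: "\<not> ?thesis"
    have "ord x dvd n" using tors(2) pow_eq_id[OF x, of n] by simp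
    then have pos: "ord x > 0" using tors(1) by (intro Nat.gr0I) simp
    from two_primes_dvd_if_not_prime_power[OF pos contr]
    obtain p q where pq: "Factorial_Ring.prime p" "Factorial_Ring.prime q" "p < q" "p * q dvd ord x"
      .
    have power: "\<exists>y\<in>carrier G. ord y = d" if d: "d dvd ord x" for d
    proof -
      obtain k where k: "ord x = d * k" using d by blast
      then have "k > 0" using pos by (intro Nat.gr0I) simp
      then have "ord (x [^] k) = d" using ord_pow[OF x, of k] by (simp add: k)
      then show ?thesis using x by blast
    qed
    show False
    proof (cases "(p, q) = (2, 3)")
      case True
      then have "2 * 3 dvd ord x" using pq(4) by simp
      then have "2 dvd ord x" "3 dvd ord x" by (rule dvd_mult_left, rule dvd_mult_right)
      then show False using power tf unfolding torsion_free_at_def by blast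
    next
      case False
      then show False using no_pq[OF pq(1-3)] power[OF pq(4)] by blast
    qed
  qed
  then show ?thesis using no_pq by blast
qed

end
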